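(* Let $n\ge2$ and let $\lambda=(\lambda_1>\dots>\lambda_n)$ be a strictly decreasing sequence of integers. In the polytope ring of the Gelfand--Zetlin polytope $GZ(\lambda)$, the following relation holds for every pair $(r,s)$ with $1\le r\le n-1$ and $1\le s\le n-r$: \[ [F^{rs}]+[F_{r+1,s}]-[F^{rs}_{r+1,s}]=[F_{rs}]+[F^{r+1,s-1}]-[F^{r+1,s-1}_{rs}]. \] Here the summands containing a pair of indices that is out of range are set to be zero.
   Context: $N=n(n-1)/2$; coordinates in $\mathbb{R}^N$ are $x_{ij}$, $i,j\ge1$, $i+j\le n$, and $x_{0,k}=\lambda_{n-k+1}$ for $1\le k\le n$. $GZ(\lambda)\subset\mathbb{R}^N$ is the polytope defined by $x_{i-1,j}\le x_{ij}\le x_{i-1,j+1}$ for all $i,j\ge1$, $i+j\le n$. $F_{ij}$ is the facet given by $x_{ij}=x_{i-1,j}$ and $F^{ij}$ is the facet given by $x_{ij}=x_{i-1,j+1}$ (pairs $(i,j)$ are in range if $i,j\ge1$ and $i+j\le n$). $F^{kl}_{ij}=F_{ij}\cap F^{kl}$. Integer convex chains are the integer linear combinations of characteristic functions $\mathbb{I}_P\colon\mathbb{Z}^N\to\mathbb{Z}$ of integral polytopes $P$ (two combinations are identified if they agree on the lattice $\mathbb{Z}^N$). The relations are in the additive group of integer convex chains modulo translation invariance, i.e. modulo the subgroup generated by all $\mathbb{I}_P-\mathbb{I}_{P+v}$ with $P$ an integral polytope and $v\in\mathbb{Z}^N$; $[P]$ is the class of $\mathbb{I}_P$. *)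

theory Defs
  imports "HOL-Analysis.Analysis" "HOL-Algebra.Elementary_Groups"
begin

text \<open>
  The space with coordinates indexed by a finite type 'k is real^'k, its lattice is int^'k.
\<close>

definition of_int_vec :: "int^'k \<Rightarrow> real^'k" where
  "of_int_vec z = (\<chi> i. real_of_int (z $ i))"

definition integral_polytope :: "(real^'k) set \<Rightarrow> bool" where
  "integral_polytope P \<longleftrightarrow>
     (\<exists>V. finite V \<and> V \<subseteq> range of_int_vec \<and> P = convex hull V)"

definition lattice_indicator :: "(real^'k) set \<Rightarrow> (int^'k \<Rightarrow> int)" where
  "lattice_indicator P = (\<lambda>z. if of_int_vec z \<in> P then 1 else 0)"

definition translate :: "(real^'k) set \<Rightarrow> int^'k \<Rightarrow> (real^'k) set" where
  "translate P v = (\<lambda>x. x + of_int_vec v) ` P"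

text \<open>
  HOL-Algebra writes groups multiplicatively: in the groups below \<open>\<otimes>\<close>, \<open>inv\<close> and
  \<open>\<one>\<close> stand for addition, negation and zero of functions on the lattice.
\<close>

definition lattice_function_group :: "(int^'k \<Rightarrow> int) monoid" where
  "lattice_function_group =
     \<lparr>carrier = UNIV, monoid.mult = (\<lambda>f g z. f z + g z), one = (\<lambda>z. 0)\<rparr>"

definition convex_chain_group :: "(int^'k \<Rightarrow> int) monoid" where
  "convex_chain_group =
     subgroup_generated lattice_function_group {lattice_indicator P |P. integral_polytope P}"

definition translation_subgroup :: "(int^'k \<Rightarrow> int) set" where
  "translation_subgroup =
     generate convex_chain_group
       {(\<lambda>z. lattice_indicator P z - lattice_indicator (translate P v) z) |P v.
          integral_polytope P}"

definition polytope_group :: "(int^'k \<Rightarrow> int) set monoid" where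
  "polytope_group = convex_chain_group Mod translation_subgroup"

definition polytope_class :: "(real^'k) set \<Rightarrow> (int^'k \<Rightarrow> int) set" where
  "polytope_class P = translation_subgroup #>\<^bsub>convex_chain_group\<^esub> lattice_indicator P"

definition gz_index :: "nat \<Rightarrow> (nat \<times> nat) set" where
  "gz_index n = {(i, j). 1 \<le> i \<and> 1 \<le> j \<and> i + j \<le> n}"

text \<open>
  The argument idx names the coordinates: it is meant to be a bijection from \<open>gz_index n\<close> onto
  the index type 'k (so CARD('k) = n(n-1)/2), and the coordinate \<open>x\<^sub>i\<^sub>j\<close> of x is
  \<open>x $ idx (i, j)\<close>. Row 0 carries the constants \<open>x\<^sub>0\<^sub>k = \<lambda>\<^sub>n\<^sub>-\<^sub>k\<^sub>+\<^sub>1\<close>;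
  only the values of lam on \<open>{1..n}\<close> are used.
\<close>

definition gz_coord ::
  "nat \<Rightarrow> (nat \<Rightarrow> int) \<Rightarrow> (nat \<times> nat \<Rightarrow> 'k) \<Rightarrow> real^'k \<Rightarrow> nat \<Rightarrow> nat \<Rightarrow> real" where
  "gz_coord n lam idx x i j =
     (if i = 0 then real_of_int (lam (n - j + 1)) else x $ idx (i, j))"

definition GZ :: "nat \<Rightarrow> (nat \<Rightarrow> int) \<Rightarrow> (nat \<times> nat \<Rightarrow> 'k) \<Rightarrow> (real^'k) set" where
  "GZ n lam idx =
     {x. \<forall>(i, j) \<in> gz_index n.
           gz_coord n lam idx x (i - 1) j \<le> gz_coord n lam idx x i j \<and>
           gz_coord n lam idx x i j \<le> gz_coord n lam idx x (i - 1) (j + 1)}"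

definition lower_facet ::
  "nat \<Rightarrow> (nat \<Rightarrow> int) \<Rightarrow> (nat \<times> nat \<Rightarrow> 'k) \<Rightarrow> nat \<times> nat \<Rightarrow> (real^'k) set" where
  "lower_facet n lam idx = (\<lambda>(i, j).
     {x \<in> GZ n lam idx. gz_coord n lam idx x i j = gz_coord n lam idx x (i - 1) j})"

definition upper_facet ::
  "nat \<Rightarrow> (nat \<Rightarrow> int) \<Rightarrow> (nat \<times> nat \<Rightarrow> 'k) \<Rightarrow> nat \<times> nat \<Rightarrow> (real^'k) set" where
  "upper_facet n lam idx = (\<lambda>(i, j).
     {x \<in> GZ n lam idx. gz_coord n lam idx x i j = gz_coord n lam idx x (i - 1) (j + 1)})"

text \<open>
  The classes \<open>[F\<^sub>i\<^sub>j]\<close>, \<open>[F\<^sup>k\<^sup>l]\<close> and \<open>[F\<^sub>i\<^sub>j \<inter> F\<^sup>k\<^sup>l]\<close>, set to zero when a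
  pair of indices is out of range.
\<close>

definition lower_class ::
  "nat \<Rightarrow> (nat \<Rightarrow> int) \<Rightarrow> (nat \<times> nat \<Rightarrow> 'k) \<Rightarrow> nat \<times> nat \<Rightarrow> (int^'k \<Rightarrow> int) set" where
  "lower_class n lam idx p =
     (if p \<in> gz_index n then polytope_class (lower_facet n lam idx p)
      else \<one>\<^bsub>polytope_group\<^esub>)"

definition upper_class ::
  "nat \<Rightarrow> (nat \<Rightarrow> int) \<Rightarrow> (nat \<times> nat \<Rightarrow> 'k) \<Rightarrow> nat \<times> nat \<Rightarrow> (int^'k \<Rightarrow> int) set" where
  "upper_class n lam idx q =
     (if q \<in> gz_index n then polytope_class (upper_facet n lam idx q)
      else \<one>\<^bsub>polytope_group\<^esub>)"

definition lower_upper_class ::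
  "nat \<Rightarrow> (nat \<Rightarrow> int) \<Rightarrow> (nat \<times> nat \<Rightarrow> 'k) \<Rightarrow> nat \<times> nat \<Rightarrow> nat \<times> nat
     \<Rightarrow> (int^'k \<Rightarrow> int) set" where
  "lower_upper_class n lam idx p q =
     (if p \<in> gz_index n \<and> q \<in> gz_index n
      then polytope_class (lower_facet n lam idx p \<inter> upper_facet n lam idx q)
      else \<one>\<^bsub>polytope_group\<^esub>)"

end

theory Submission
  imports Defs
begin

text \<open>
  Write \<open>x = x\<^sub>r\<^sub>s\<close>. With the other coordinates of a point of \<open>GZ(\<lambda>)\<close> fixed, \<open>x\<close> ranges over an
  interval whose upper bounds are \<open>x\<^sub>r\<^sub>-\<^sub>1\<^sub>,\<^sub>s\<^sub>+\<^sub>1\<close> and (when in range) \<open>x\<^sub>r\<^sub>+\<^sub>1\<^sub>,\<^sub>s\<close>, and whose lower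
  bounds are \<open>x\<^sub>r\<^sub>-\<^sub>1\<^sub>,\<^sub>s\<close> and (when in range) \<open>x\<^sub>r\<^sub>+\<^sub>1\<^sub>,\<^sub>s\<^sub>-\<^sub>1\<close>. By inclusion and exclusion the
  left-hand side of the relation is the class of the indicator of the points at the upper end of
  their interval (lemma \<open>top_chain\<close>), and the right-hand side is the class of the indicator of the
  points at the lower end (lemma \<open>bottom_chain\<close>).

  Let \<open>e\<close> be the unit vector in the direction of \<open>x\<close>. On the lattice the indicator of the polytope
  minus that of its translate by \<open>e\<close> is the indicator of the bottom minus the indicator of the top
  translated by \<open>e\<close> (lemma \<open>GZ_minus_shift\<close>). The first difference vanishes modulo translation, and
  the top, being a convex chain, has the class of its translate; hence top and bottom have equal
  classes (lemma \<open>chain_class_eq_by_shift\<close>).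

  This requires the polytope and the faces involved to be integral. A vertex is shown to be integral
  by writing it as the midpoint of two points of the polytope obtained by bending its nonintegral
  coordinates: all constraints compare two coordinates or a coordinate and an integer, so they
  survive a nondecreasing map of the line that fixes the integers (lemma
  \<open>integral_polytope_if_bend_stable\<close>). The Krein--Milman theorem then gives integrality.
\<close>

section \<open>Convex chains modulo translation\<close>

lemma comm_group_lattice_function_group:
  "comm_group (lattice_function_group :: (int^'k \<Rightarrow> int) monoid)"
proof (rule comm_groupI)
  fix f :: "int^'k \<Rightarrow> int"
  show "\<exists>g\<in>carrier lattice_function_group. g \<otimes>\<^bsub>lattice_function_group\<^esub> f = \<one>\<^bsub>lattice_function_group\<^esub>"
    by (rule bexI[where x = "\<lambda>z. - f z"]) (auto simp: lattice_function_group_def)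
qed (auto simp: lattice_function_group_def algebra_simps)

lemma group_lattice_function_group: "group lattice_function_group"
  using comm_group_lattice_function_group comm_group_def by blast

lemma inv_lattice_function_group:
  "inv\<^bsub>lattice_function_group\<^esub> f = (\<lambda>z. - f z)"
  by (rule group.inv_equality[OF group_lattice_function_group])
    (auto simp: lattice_function_group_def)

lemma comm_group_convex_chain_group: "comm_group convex_chain_group"
  unfolding convex_chain_group_def
  by (rule group.abelian_subgroup_generated[OF group_lattice_function_group
        comm_group_lattice_function_group])

lemma group_convex_chain_group: "group convex_chain_group"
  using comm_group_convex_chain_group comm_group_def by blast

lemma one_convex_chain_group: "\<one>\<^bsub>convex_chain_group\<^esub> = (\<lambda>z. 0)"
  by (simp add: convex_chain_group_def lattice_function_group_def)

lemma mult_convex_chain_group: "f \<otimes>\<^bsub>convex_chain_group\<^esub> g = (\<lambda>z. f z + g z)"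
  by (simp add: convex_chain_group_def lattice_function_group_def)

lemma inv_convex_chain_group:
  assumes "f \<in> carrier convex_chain_group"
  shows "inv\<^bsub>convex_chain_group\<^esub> f = (\<lambda>z. - f z)"
  using assms unfolding convex_chain_group_def
  by (simp add: group.inv_subgroup_generated[OF group_lattice_function_group]
      inv_lattice_function_group)

lemma lattice_indicator_eq_of_bool: "lattice_indicator P z = of_bool (of_int_vec z \<in> P)"
  by (simp add: lattice_indicator_def)

lemma lattice_indicator_convex_chain:
  assumes "integral_polytope P"
  shows "lattice_indicator P \<in> carrier convex_chain_group"
  using assms
  by (auto simp: convex_chain_group_def carrier_subgroup_generated lattice_function_group_def
      intro: generate.incl)

lemma zero_convex_chain: "(\<lambda>z. 0) \<in> carrier convex_chain_group"
  using group.is_monoid[OF group_convex_chain_group, THEN monoid.one_closed]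
  by (simp add: one_convex_chain_group)

lemma add_convex_chain:
  assumes "f \<in> carrier convex_chain_group" "g \<in> carrier convex_chain_group"
  shows "(\<lambda>z. f z + g z) \<in> carrier convex_chain_group"
  using monoid.m_closed[OF group.is_monoid[OF group_convex_chain_group] assms]
  by (simp add: mult_convex_chain_group)

lemma uminus_convex_chain:
  assumes "f \<in> carrier convex_chain_group"
  shows "(\<lambda>z. - f z) \<in> carrier convex_chain_group"
  using group.inv_closed[OF group_convex_chain_group assms]
  by (simp add: inv_convex_chain_group[OF assms])

lemma diff_convex_chain:
  assumes "f \<in> carrier convex_chain_group" "g \<in> carrier convex_chain_group"
  shows "(\<lambda>z. f z - g z) \<in> carrier convex_chain_group"
  using add_convex_chain[OF assms(1) uminus_convex_chain[OF assms(2)]] by simp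

lemma of_int_vec_add: "of_int_vec (z + w) = of_int_vec z + of_int_vec w"
  by (simp add: of_int_vec_def vec_eq_iff)

lemma of_int_vec_diff: "of_int_vec (z - w) = of_int_vec z - of_int_vec w"
  by (simp add: of_int_vec_def vec_eq_iff)

lemma lattice_indicator_translate:
  "lattice_indicator (translate P v) z = lattice_indicator P (z - v)"
proof -
  have "of_int_vec z \<in> translate P v \<longleftrightarrow> of_int_vec (z - v) \<in> P"
    by (force simp: translate_def of_int_vec_diff image_iff)
  then show ?thesis by (simp add: lattice_indicator_def)
qed

lemma integral_polytope_translate:
  assumes "integral_polytope P"
  shows "integral_polytope (translate P v)"
proof -
  obtain V where V: "finite V" "V \<subseteq> range of_int_vec" "P = convex hull V"
    using assms by (auto simp: integral_polytope_def)
  have eq: "translate P v = convex hull ((\<lambda>x. of_int_vec v + x) ` V)"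
    unfolding convex_hull_translation V translate_def by (simp add: add.commute)
  have "(\<lambda>x. of_int_vec v + x) ` V \<subseteq> range of_int_vec"
    using V(2) by (force simp flip: of_int_vec_add)
  then show ?thesis
    unfolding integral_polytope_def using V(1) eq by blast
qed

lemma translation_generator_convex_chain:
  assumes "integral_polytope P"
  shows "(\<lambda>z. lattice_indicator P z - lattice_indicator (translate P v) z)
           \<in> carrier convex_chain_group"
  by (intro diff_convex_chain lattice_indicator_convex_chain integral_polytope_translate assms)

lemma subgroup_translation_subgroup: "subgroup translation_subgroup convex_chain_group"
  unfolding translation_subgroup_def
  by (rule group.generate_is_subgroup[OF group_convex_chain_group])
    (auto intro: translation_generator_convex_chain)

lemma normal_translation_subgroup: "translation_subgroup \<lhd> convex_chain_group"
  by (rule comm_group.subgroup_imp_normal[OF comm_group_convex_chain_group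
        subgroup_translation_subgroup])

lemma add_translation_subgroup:
  assumes "f \<in> translation_subgroup" "g \<in> translation_subgroup"
  shows "(\<lambda>z. f z + g z) \<in> translation_subgroup"
  using subgroup.m_closed[OF subgroup_translation_subgroup assms]
  by (simp add: mult_convex_chain_group)

lemma uminus_translation_subgroup:
  assumes "f \<in> translation_subgroup"
  shows "(\<lambda>z. - f z) \<in> translation_subgroup"
  using subgroup.m_inv_closed[OF subgroup_translation_subgroup assms]
    inv_convex_chain_group[OF subgroup.mem_carrier[OF subgroup_translation_subgroup assms]]
  by simp

lemma indicator_minus_shift_in_translation_subgroup:
  assumes "integral_polytope P"
  shows "(\<lambda>z. lattice_indicator P z - lattice_indicator P (z - v)) \<in> translation_subgroup"
proof -
  have "(\<lambda>z. lattice_indicator P z - lattice_indicator (translate P v) z) \<in> translation_subgroup"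
    unfolding translation_subgroup_def using assms by (blast intro: generate.incl)
  then show ?thesis by (simp add: lattice_indicator_translate)
qed

text \<open>Translation invariance passes from indicators of polytopes to all convex chains.\<close>

lemma chain_minus_shift_in_translation_subgroup:
  assumes "f \<in> carrier convex_chain_group"
  shows "(\<lambda>z. f z - f (z - v)) \<in> translation_subgroup"
proof -
  have "f \<in> generate lattice_function_group
          (carrier lattice_function_group \<inter> {lattice_indicator P |P. integral_polytope P})"
    using assms by (simp add: convex_chain_group_def carrier_subgroup_generated)
  then show ?thesis
  proof induction
    case one
    then show ?case
      using subgroup.one_closed[OF subgroup_translation_subgroup]
      by (simp add: one_convex_chain_group lattice_function_group_def)
  next
    case (incl h)
    then show ?case by (auto intro: indicator_minus_shift_in_translation_subgroup)
  next
    case (inv h)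
    then have "(\<lambda>z. h z - h (z - v)) \<in> translation_subgroup"
      by (auto intro: indicator_minus_shift_in_translation_subgroup)
    from uminus_translation_subgroup[OF this] show ?case
      by (simp add: inv_lattice_function_group algebra_simps)
  next
    case (eng h1 h2)
    from add_translation_subgroup[OF eng.IH] show ?case
      by (simp add: lattice_function_group_def algebra_simps)
  qed
qed

text \<open>The class of a convex chain modulo translation.\<close>

definition chain_class :: "(int^'k \<Rightarrow> int) \<Rightarrow> (int^'k \<Rightarrow> int) set" where
  "chain_class f = translation_subgroup #>\<^bsub>convex_chain_group\<^esub> f"

lemma chain_class_hom: "chain_class \<in> hom convex_chain_group polytope_group"
  using normal.r_coset_hom_Mod[OF normal_translation_subgroup]
  by (simp add: chain_class_def[abs_def] polytope_group_def)

lemma chain_class_add: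
  assumes "f \<in> carrier convex_chain_group" "g \<in> carrier convex_chain_group"
  shows "chain_class f \<otimes>\<^bsub>polytope_group\<^esub> chain_class g = chain_class (\<lambda>z. f z + g z)"
  using hom_mult[OF chain_class_hom assms] by (simp add: mult_convex_chain_group)

lemma group_polytope_group: "group polytope_group"
  unfolding polytope_group_def
  by (rule normal.factorgroup_is_group[OF normal_translation_subgroup])

lemma chain_class_uminus:
  assumes "f \<in> carrier convex_chain_group"
  shows "inv\<^bsub>polytope_group\<^esub> chain_class f = chain_class (\<lambda>z. - f z)"
proof -
  interpret group_hom convex_chain_group polytope_group chain_class
    by (rule group_hom.intro[OF group_convex_chain_group group_polytope_group])
      (simp add: group_hom_axioms_def chain_class_hom)
  show ?thesis
    using hom_inv[OF assms] by (simp add: inv_convex_chain_group[OF assms])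
qed

lemma chain_class_zero: "chain_class (\<lambda>z. 0) = \<one>\<^bsub>polytope_group\<^esub>"
  using hom_one[OF chain_class_hom group_convex_chain_group group_polytope_group]
  by (simp add: one_convex_chain_group)

lemma polytope_class_if:
  "(if c then polytope_class P else \<one>\<^bsub>polytope_group\<^esub>) =
     chain_class (if c then lattice_indicator P else (\<lambda>z. 0))"
  by (simp add: polytope_class_def chain_class_zero flip: chain_class_def)

lemma chain_class_eqI:
  assumes "f \<in> carrier convex_chain_group" "g \<in> carrier convex_chain_group"
    and "(\<lambda>z. f z - g z) \<in> translation_subgroup"
  shows "chain_class f = chain_class g"
proof -
  have "f = (\<lambda>z. f z - g z) \<otimes>\<^bsub>convex_chain_group\<^esub> g"
    by (simp add: mult_convex_chain_group)
  then have "f \<in> translation_subgroup #>\<^bsub>convex_chain_group\<^esub> g"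
    using assms(3) unfolding r_coset_def by blast
  then show ?thesis
    unfolding chain_class_def
    using group.repr_independence[OF group_convex_chain_group _ assms(2)
        subgroup_translation_subgroup] by simp
qed

text \<open>
  If the indicator of an integral polytope loses \<open>f\<close> and gains a translate of \<open>g\<close> when the
  polytope is translated, then \<open>f\<close> and \<open>g\<close> have the same class.
\<close>

lemma chain_class_eq_by_shift:
  assumes f: "f \<in> carrier convex_chain_group" and g: "g \<in> carrier convex_chain_group"
    and P: "integral_polytope P"
    and eq: "\<And>z. lattice_indicator P z - lattice_indicator P (z - v) = f z - g (z - v)"
  shows "chain_class f = chain_class g"
proof (rule chain_class_eqI[OF f g])
  have "(\<lambda>z. (lattice_indicator P z - lattice_indicator P (z - v)) + - (g z - g (z - v)))
          \<in> translation_subgroup"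
    by (intro add_translation_subgroup uminus_translation_subgroup
        indicator_minus_shift_in_translation_subgroup
        chain_minus_shift_in_translation_subgroup P g)
  then show "(\<lambda>z. f z - g z) \<in> translation_subgroup" by (simp add: eq)
qed

section \<open>A criterion for integrality of polytopes\<close>

text \<open>
  A perturbation of the real line that fixes the integers and, for \<open>e \<noteq> 0\<close>, moves every nonintegral
  number. It is nondecreasing for \<open>\<bar>e\<bar> \<le> 1\<close>, and the perturbations for \<open>e\<close> and \<open>-e\<close> average to the
  identity.
\<close>

definition bend :: "real \<Rightarrow> real \<Rightarrow> real" where
  "bend e t = t + e * (frac t * (1 - frac t))"

lemma bend_of_int [simp]: "bend e (of_int k) = of_int k"
  by (simp add: bend_def)

lemma bend_bounds:
  assumes "\<bar>e\<bar> \<le> 1"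
  shows "of_int \<lfloor>t\<rfloor> \<le> bend e t" and "bend e t \<le> of_int \<lfloor>t\<rfloor> + 1"
proof -
  define p where "p = frac t"
  have p: "0 \<le> p" "p \<le> 1" using frac_lt_1[of t] by (auto simp: p_def)
  have t: "t = of_int \<lfloor>t\<rfloor> + p" by (simp add: p_def frac_def)
  define y where "y = e * (p * (1 - p))"
  have "\<bar>y\<bar> \<le> 1 * (p * (1 - p))"
    unfolding y_def abs_mult using assms p by (intro mult_mono) auto
  then have "\<bar>y\<bar> \<le> p - p\<^sup>2" by (simp add: power2_eq_square algebra_simps)
  moreover have "0 \<le> p\<^sup>2" "0 \<le> 1 - 2 * p + p\<^sup>2"
    using zero_le_power2[of "1 - p"] by (simp_all add: power2_diff)
  ultimately have "0 \<le> p + y" "p + y \<le> 1" by linarith+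
  then show "of_int \<lfloor>t\<rfloor> \<le> bend e t" "bend e t \<le> of_int \<lfloor>t\<rfloor> + 1"
    using t unfolding bend_def p_def[symmetric] y_def[symmetric] by linarith+
qed

lemma bend_mono:
  assumes e: "\<bar>e\<bar> \<le> 1" and "s \<le> t"
  shows "bend e s \<le> bend e t"
proof (cases "\<lfloor>s\<rfloor> = \<lfloor>t\<rfloor>")
  case True
  have "bend e t - bend e s = (t - s) * (1 + e * (1 - frac s - frac t))"
    unfolding bend_def frac_def True by (simp add: algebra_simps)
  moreover have "\<bar>e * (1 - frac s - frac t)\<bar> \<le> 1 * 1"
    unfolding abs_mult using e frac_lt_1[of s] frac_lt_1[of t] frac_ge_0[of s] frac_ge_0[of t]
    by (intro mult_mono) (auto simp: abs_le_iff simp del: frac_ge_0)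
  ultimately show ?thesis
    using \<open>s \<le> t\<close> by (smt (verit) mult_nonneg_nonneg)
next
  case False
  then have "\<lfloor>s\<rfloor> + 1 \<le> \<lfloor>t\<rfloor>" using floor_mono[OF \<open>s \<le> t\<close>] by linarith
  then have "of_int \<lfloor>s\<rfloor> + 1 \<le> (of_int \<lfloor>t\<rfloor> :: real)" by linarith
  then show ?thesis using bend_bounds[OF e, of s] bend_bounds[OF e, of t] by linarith
qed

lemma bend_eq_self_imp_int:
  assumes "bend e t = t" and "e \<noteq> 0"
  shows "t \<in> \<int>"
  using assms frac_lt_1[of t] by (auto simp: bend_def)

text \<open>The perturbation applied to every coordinate.\<close>

definition bend_vec :: "real \<Rightarrow> real^'k \<Rightarrow> real^'k" where
  "bend_vec e x = (\<chi> i. bend e (x $ i))"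

lemma finite_bounded_int_vecs:
  fixes S :: "(real^'k::finite) set"
  assumes "bounded S" and "S \<subseteq> range of_int_vec"
  shows "finite S"
proof -
  obtain B where B: "\<And>x. x \<in> S \<Longrightarrow> norm x \<le> B"
    using assms(1) by (auto simp: bounded_iff)
  define K where "K = {k \<in> \<int>. \<bar>k\<bar> \<le> B}"
  have "finite K" unfolding K_def by (rule finite_abs_int_segment)
  then have "finite (vec_lambda ` {f :: 'k \<Rightarrow> real. \<forall>i. f i \<in> K})"
    by (intro finite_imageI) (simp add: finite_set_of_finite_funs[of UNIV K, simplified])
  moreover have "S \<subseteq> vec_lambda ` {f. \<forall>i. f i \<in> K}"
  proof
    fix x assume x: "x \<in> S"
    then obtain z where z: "x = of_int_vec z" using assms(2) by auto
    have "x $ i \<in> K" for i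
      using B[OF x] component_le_norm_cart[of x i] unfolding K_def z
      by (simp add: of_int_vec_def)
    then have "x = vec_lambda (vec_nth x)" "vec_nth x \<in> {f. \<forall>i. f i \<in> K}" by auto
    then show "x \<in> vec_lambda ` {f. \<forall>i. f i \<in> K}" by blast
  qed
  ultimately show ?thesis by (rule finite_subset[rotated])
qed

text \<open>
  A point is the midpoint of its two bendings, so the extreme points of a set stable under bending
  are fixed by it, that is, integral.
\<close>

lemma integral_polytope_if_bend_stable:
  fixes P :: "(real^'k::finite) set"
  assumes "compact P" "convex P"
    and bend: "\<And>e x. \<bar>e\<bar> \<le> 1 \<Longrightarrow> x \<in> P \<Longrightarrow> bend_vec e x \<in> P"
  shows "integral_polytope P"
proof -
  define V where "V = {x. x extreme_point_of P}"
  have VP: "V \<subseteq> P" by (auto simp: V_def extreme_point_of_def)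
  have V: "V \<subseteq> range of_int_vec"
  proof
    fix x assume "x \<in> V"
    then have x: "x \<in> P" and ext: "\<And>a b. a \<in> P \<Longrightarrow> b \<in> P \<Longrightarrow> x \<notin> open_segment a b"
      by (auto simp: V_def extreme_point_of_def)
    have mid: "midpoint (bend_vec 1 x) (bend_vec (-1) x) = x"
      by (simp add: midpoint_def bend_vec_def bend_def vec_eq_iff)
    have eq: "bend_vec 1 x = bend_vec (-1) x"
    proof (rule ccontr)
      assume "bend_vec 1 x \<noteq> bend_vec (-1) x"
      then have "x \<in> open_segment (bend_vec 1 x) (bend_vec (-1) x)"
        using midpoint_in_open_segment[of "bend_vec 1 x" "bend_vec (-1) x", unfolded mid]
        by blast
      moreover have "bend_vec 1 x \<in> P" "bend_vec (-1) x \<in> P"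
        using x by (auto intro: bend)
      ultimately show False using ext by blast
    qed
    have "bend_vec 1 x = x" using mid by (simp add: eq)
    then have "bend 1 (x $ i) = x $ i" for i
      by (metis bend_vec_def vec_lambda_beta)
    then have int: "x $ i \<in> \<int>" for i
      by (rule bend_eq_self_imp_int) simp
    have "x = of_int_vec (\<chi> i. \<lfloor>x $ i\<rfloor>)"
      using int by (simp add: of_int_vec_def vec_eq_iff)
    then show "x \<in> range of_int_vec" by (rule range_eqI)
  qed
  moreover have "finite V"
    using finite_bounded_int_vecs[OF bounded_subset[OF compact_imp_bounded[OF assms(1)] VP] V] .
  moreover have "P = convex hull V"
    unfolding V_def by (rule Krein_Milman_Minkowski[OF assms(1,2)])
  ultimately show ?thesis unfolding integral_polytope_def by blast
qed

section \<open>Gelfand--Zetlin polytopes and their faces are integral\<close>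

lemma gz_coord_bend_vec:
  "gz_coord n lam idx (bend_vec e x) i j = bend e (gz_coord n lam idx x i j)"
  by (simp add: gz_coord_def bend_vec_def)

lemma bend_vec_GZ:
  assumes "\<bar>e\<bar> \<le> 1" "x \<in> GZ n lam idx"
  shows "bend_vec e x \<in> GZ n lam idx"
  using assms by (auto simp: GZ_def gz_coord_bend_vec intro: bend_mono)

lemma continuous_gz_coord: "continuous_on UNIV (\<lambda>x. gz_coord n lam idx x i j)"
  by (cases "i = 0") (auto simp: gz_coord_def intro!: continuous_intros)

lemma GZ_eq_INT:
  "GZ n lam idx = (\<Inter>(i, j) \<in> gz_index n.
     {x. gz_coord n lam idx x (i - 1) j \<le> gz_coord n lam idx x i j} \<inter>
     {x. gz_coord n lam idx x i j \<le> gz_coord n lam idx x (i - 1) (j + 1)})"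
  by (auto simp: GZ_def)

lemma gz_coord_convex_combination:
  assumes "u + v = 1"
  shows "gz_coord n lam idx (u *\<^sub>R x + v *\<^sub>R y) i j =
           u * gz_coord n lam idx x i j + v * gz_coord n lam idx y i j"
  using assms by (simp add: gz_coord_def flip: distrib_right)

lemma convex_gz_le:
  "convex {x. gz_coord n lam idx x i j \<le> gz_coord n lam idx x i' j'}"
  by (rule convexI) (simp add: gz_coord_convex_combination add_mono mult_left_mono)

lemma closed_gz_le:
  "closed {x. gz_coord n lam idx x i j \<le> gz_coord n lam idx x i' j'}"
  by (rule closed_Collect_le[OF continuous_gz_coord continuous_gz_coord])

lemma convex_gz_eq:
  "convex {x. gz_coord n lam idx x i j = gz_coord n lam idx x i' j'}"
  by (rule convexI) (simp add: gz_coord_convex_combination)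

lemma closed_gz_eq:
  "closed {x. gz_coord n lam idx x i j = gz_coord n lam idx x i' j'}"
  by (rule closed_Collect_eq[OF continuous_gz_coord continuous_gz_coord])

lemma convex_GZ: "convex (GZ n lam idx)"
  unfolding GZ_eq_INT by (auto intro!: convex_INT convex_Int convex_gz_le)

lemma closed_GZ: "closed (GZ n lam idx)"
  unfolding GZ_eq_INT by (auto intro!: closed_INT closed_Int closed_gz_le)

lemma gz_coord_bounded:
  assumes x: "x \<in> GZ n lam idx"
    and "\<And>k. k \<in> {1..n} \<Longrightarrow> \<bar>real_of_int (lam k)\<bar> \<le> B"
    and "1 \<le> j" "i + j \<le> n"
  shows "\<bar>gz_coord n lam idx x i j\<bar> \<le> B"
  using assms(3,4)
proof (induction i arbitrary: j)
  case 0
  then show ?case by (simp add: gz_coord_def assms(2))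
next
  case (Suc i)
  then have "(Suc i, j) \<in> gz_index n" by (simp add: gz_index_def)
  with x have "gz_coord n lam idx x i j \<le> gz_coord n lam idx x (Suc i) j"
    "gz_coord n lam idx x (Suc i) j \<le> gz_coord n lam idx x i (Suc j)"
    by (auto simp: GZ_def)
  moreover have "\<bar>gz_coord n lam idx x i j\<bar> \<le> B" "\<bar>gz_coord n lam idx x i (Suc j)\<bar> \<le> B"
    using Suc.prems by (auto intro!: Suc.IH)
  ultimately show ?case by linarith
qed

lemma bounded_GZ:
  fixes idx :: "nat \<times> nat \<Rightarrow> 'k::finite"
  assumes idx: "idx ` gz_index n = UNIV"
  shows "bounded (GZ n lam idx)"
proof -
  define B where "B = (\<Sum>k\<in>{1..n}. \<bar>real_of_int (lam k)\<bar>)"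
  have B: "\<bar>real_of_int (lam k)\<bar> \<le> B" if "k \<in> {1..n}" for k
    unfolding B_def using that by (intro member_le_sum) auto
  have comp: "\<bar>x $ l\<bar> \<le> B" if x: "x \<in> GZ n lam idx" for x l
  proof -
    obtain i j where ij: "(i, j) \<in> gz_index n" "l = idx (i, j)"
      using idx by (metis UNIV_I imageE surj_pair)
    then have "\<bar>gz_coord n lam idx x i j\<bar> \<le> B"
      by (intro gz_coord_bounded[OF x B]) (auto simp: gz_index_def)
    then show ?thesis using ij by (simp add: gz_coord_def gz_index_def)
  qed
  have "norm x \<le> (\<Sum>l\<in>(UNIV :: 'k set). B)" if "x \<in> GZ n lam idx" for x
    using norm_le_l1_cart[of x] sum_mono[of UNIV "\<lambda>l. \<bar>x $ l\<bar>" "\<lambda>_. B"] comp[OF that]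
    by (meson order_trans)
  then show ?thesis by (auto simp: bounded_iff)
qed

text \<open>
  The set \<open>E\<close> lists the pairs of coordinates that are required to be equal. Such an equation, like
  the inequalities of the polytope, is preserved by bending.
\<close>

lemma integral_polytope_GZ_face:
  fixes idx :: "nat \<times> nat \<Rightarrow> 'k::finite"
  assumes idx: "idx ` gz_index n = UNIV"
  shows "integral_polytope {x \<in> GZ n lam idx.
           \<forall>(p, q) \<in> E. gz_coord n lam idx x (fst p) (snd p) = gz_coord n lam idx x (fst q) (snd q)}"
    (is "integral_polytope ?F")
proof (rule integral_polytope_if_bend_stable)
  have F: "?F = GZ n lam idx \<inter> (\<Inter>(p, q) \<in> E.
      {x. gz_coord n lam idx x (fst p) (snd p) = gz_coord n lam idx x (fst q) (snd q)})"
    by blast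
  show "convex ?F"
    unfolding F by (auto intro!: convex_INT convex_Int convex_gz_eq convex_GZ)
  have "closed ?F"
    unfolding F by (auto intro!: closed_INT closed_Int closed_gz_eq closed_GZ)
  moreover have "bounded ?F"
    by (rule bounded_subset[OF bounded_GZ[OF idx]]) auto
  ultimately show "compact ?F" by (simp add: compact_eq_bounded_closed)
  show "bend_vec e x \<in> ?F" if "\<bar>e\<bar> \<le> 1" "x \<in> ?F" for e x
    using that by (auto simp: gz_coord_bend_vec bend_vec_GZ)
qed

lemma integral_polytope_GZ:
  fixes idx :: "nat \<times> nat \<Rightarrow> 'k::finite"
  assumes "idx ` gz_index n = UNIV"
  shows "integral_polytope (GZ n lam idx)"
  using integral_polytope_GZ_face[OF assms, of lam "{}"] by simp

lemma integral_polytope_lower_facet: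
  fixes idx :: "nat \<times> nat \<Rightarrow> 'k::finite"
  assumes "idx ` gz_index n = UNIV"
  shows "integral_polytope (lower_facet n lam idx p)"
  using integral_polytope_GZ_face[OF assms, of lam "{(p, (fst p - 1, snd p))}"]
  by (simp add: lower_facet_def case_prod_beta)

lemma integral_polytope_upper_facet:
  fixes idx :: "nat \<times> nat \<Rightarrow> 'k::finite"
  assumes "idx ` gz_index n = UNIV"
  shows "integral_polytope (upper_facet n lam idx p)"
  using integral_polytope_GZ_face[OF assms, of lam "{(p, (fst p - 1, snd p + 1))}"]
  by (simp add: upper_facet_def case_prod_beta)

lemma integral_polytope_lower_Int_upper_facet:
  fixes idx :: "nat \<times> nat \<Rightarrow> 'k::finite"
  assumes "idx ` gz_index n = UNIV"
  shows "integral_polytope (lower_facet n lam idx p \<inter> upper_facet n lam idx q)"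
proof -
  let ?E = "{(p, (fst p - 1, snd p)), (q, (fst q - 1, snd q + 1))}"
  have "lower_facet n lam idx p \<inter> upper_facet n lam idx q = {x \<in> GZ n lam idx. \<forall>(p, q) \<in> ?E.
      gz_coord n lam idx x (fst p) (snd p) = gz_coord n lam idx x (fst q) (snd q)}"
    unfolding lower_facet_def upper_facet_def case_prod_beta by fastforce
  then show ?thesis using integral_polytope_GZ_face[OF assms, of lam ?E] by (simp only:)
qed

section \<open>Lattice points of the polytope along one coordinate\<close>

text \<open>The coordinates of a lattice point, as integers; row 0 carries the constants.\<close>

definition gz_int_coord ::
  "nat \<Rightarrow> (nat \<Rightarrow> int) \<Rightarrow> (nat \<times> nat \<Rightarrow> 'k) \<Rightarrow> int^'k \<Rightarrow> nat \<Rightarrow> nat \<Rightarrow> int" where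
  "gz_int_coord n lam idx z i j = (if i = 0 then lam (n - j + 1) else z $ idx (i, j))"

lemma gz_coord_of_int_vec:
  "gz_coord n lam idx (of_int_vec z) i j = of_int (gz_int_coord n lam idx z i j)"
  by (simp add: gz_coord_def gz_int_coord_def of_int_vec_def)

lemma of_int_vec_mem_GZ:
  "of_int_vec z \<in> GZ n lam idx \<longleftrightarrow>
     (\<forall>(i, j) \<in> gz_index n. gz_int_coord n lam idx z (i - 1) j \<le> gz_int_coord n lam idx z i j \<and>
        gz_int_coord n lam idx z i j \<le> gz_int_coord n lam idx z (i - 1) (j + 1))"
  by (auto simp: GZ_def gz_coord_of_int_vec)

lemma of_int_vec_mem_lower_facet:
  "of_int_vec z \<in> lower_facet n lam idx (i, j) \<longleftrightarrow> of_int_vec z \<in> GZ n lam idx \<and>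
     gz_int_coord n lam idx z i j = gz_int_coord n lam idx z (i - 1) j"
  by (auto simp: lower_facet_def gz_coord_of_int_vec)

lemma of_int_vec_mem_upper_facet:
  "of_int_vec z \<in> upper_facet n lam idx (i, j) \<longleftrightarrow> of_int_vec z \<in> GZ n lam idx \<and>
     gz_int_coord n lam idx z i j = gz_int_coord n lam idx z (i - 1) (j + 1)"
  by (auto simp: upper_facet_def gz_coord_of_int_vec)

text \<open>
  The inequalities of the polytope that do not involve the coordinate \<open>x\<^sub>r\<^sub>s\<close>.
\<close>

definition gz_rest ::
  "nat \<Rightarrow> (nat \<Rightarrow> int) \<Rightarrow> (nat \<times> nat \<Rightarrow> 'k) \<Rightarrow> nat \<Rightarrow> nat \<Rightarrow> int^'k \<Rightarrow> bool" where
  "gz_rest n lam idx r s z \<longleftrightarrow> (\<forall>(i, j) \<in> gz_index n. (i, j) \<noteq> (r, s) \<longrightarrow>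
     ((i - 1, j) \<noteq> (r, s) \<longrightarrow> gz_int_coord n lam idx z (i - 1) j \<le> gz_int_coord n lam idx z i j) \<and>
     ((i - 1, j + 1) \<noteq> (r, s) \<longrightarrow>
        gz_int_coord n lam idx z i j \<le> gz_int_coord n lam idx z (i - 1) (j + 1)))"

text \<open>
  The coordinate \<open>x\<^sub>r\<^sub>s\<close> is bounded by its two neighbours in row \<open>r - 1\<close>, and by those of its two
  neighbours in row \<open>r + 1\<close> that exist.
\<close>

lemma of_int_vec_mem_GZ_split:
  assumes rs: "(r, s) \<in> gz_index n"
  shows "of_int_vec z \<in> GZ n lam idx \<longleftrightarrow> gz_rest n lam idx r s z \<and>
     gz_int_coord n lam idx z (r - 1) s \<le> gz_int_coord n lam idx z r s \<and>
     gz_int_coord n lam idx z r s \<le> gz_int_coord n lam idx z (r - 1) (s + 1) \<and>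
     ((r + 1, s) \<in> gz_index n \<longrightarrow>
        gz_int_coord n lam idx z r s \<le> gz_int_coord n lam idx z (r + 1) s) \<and>
     ((r + 1, s - 1) \<in> gz_index n \<longrightarrow>
        gz_int_coord n lam idx z (r + 1) (s - 1) \<le> gz_int_coord n lam idx z r s)"
    (is "?L \<longleftrightarrow> ?R")
proof -
  let ?c = "gz_int_coord n lam idx z"
  have s: "s - 1 + 1 = s" using rs by (simp add: gz_index_def)
  show ?thesis
  proof
    assume ?L
    note L = this[unfolded of_int_vec_mem_GZ]
    have le: "?c (i - 1) j \<le> ?c i j" "?c i j \<le> ?c (i - 1) (j + 1)"
      if "(i, j) \<in> gz_index n" for i j
      using bspec[OF L that] by (simp_all only: prod.case)
    have "gz_rest n lam idx r s z"
      unfolding gz_rest_def by (rule ballI) (simp only: le split_paired_all prod.case simp_thms)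
    moreover have "?c r s \<le> ?c (r + 1) s" if "(r + 1, s) \<in> gz_index n"
      using le(1)[OF that] by (simp only: add_diff_cancel_right')
    moreover have "?c (r + 1) (s - 1) \<le> ?c r s" if "(r + 1, s - 1) \<in> gz_index n"
      using le(2)[OF that] by (simp only: add_diff_cancel_right' s)
    ultimately show ?R using le[OF rs] by blast
  next
    assume R: ?R
    have "?c (i - 1) j \<le> ?c i j \<and> ?c i j \<le> ?c (i - 1) (j + 1)"
      if ij: "(i, j) \<in> gz_index n" for i j
    proof -
      have i: "1 \<le> i" using ij by (simp add: gz_index_def)
      have rest_ij: "(i, j) \<noteq> (r, s) \<longrightarrow>
          ((i - 1, j) \<noteq> (r, s) \<longrightarrow> ?c (i - 1) j \<le> ?c i j) \<and>
          ((i - 1, j + 1) \<noteq> (r, s) \<longrightarrow> ?c i j \<le> ?c (i - 1) (j + 1))"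
        using bspec[OF conjunct1[OF R, unfolded gz_rest_def] ij] by (simp only: prod.case)
      have rest: "?c (i - 1) j \<le> ?c i j" if "(i, j) \<noteq> (r, s)" "(i - 1, j) \<noteq> (r, s)"
        using rest_ij that by blast
      have rest': "?c i j \<le> ?c (i - 1) (j + 1)" if "(i, j) \<noteq> (r, s)" "(i - 1, j + 1) \<noteq> (r, s)"
        using rest_ij that by blast
      have "?c (i - 1) j \<le> ?c i j" if eq: "(i - 1, j) = (r, s)"
      proof -
        have eq': "i = r + 1" "j = s" using eq i by auto
        show ?thesis using R ij unfolding eq' add_diff_cancel_right' by blast
      qed
      moreover have "?c i j \<le> ?c (i - 1) (j + 1)" if eq: "(i - 1, j + 1) = (r, s)"
      proof -
        have eq': "i = r + 1" "j = s - 1" using eq i by auto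
        show ?thesis using R ij unfolding eq' add_diff_cancel_right' s by blast
      qed
      moreover have "?c (i - 1) j \<le> ?c i j \<and> ?c i j \<le> ?c (i - 1) (j + 1)" if "(i, j) = (r, s)"
        using conjunct2[OF R] that unfolding prod.inject by blast
      ultimately show ?thesis using rest rest' by metis
    qed
    then show ?L
      unfolding of_int_vec_mem_GZ by (intro ballI) (simp only: split_paired_all prod.case simp_thms)
  qed
qed

lemma gz_int_coord_shift:
  assumes inj: "inj_on idx (gz_index n)" and "(r, s) \<in> gz_index n"
    and "i = 0 \<or> (i, j) \<in> gz_index n"
  shows "gz_int_coord n lam idx (z - axis (idx (r, s)) 1) i j =
           gz_int_coord n lam idx z i j - (if (i, j) = (r, s) then 1 else 0)"
proof (cases "i = 0")
  case True
  then show ?thesis using assms(2) by (auto simp: gz_int_coord_def gz_index_def)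
next
  case False
  then have "idx (i, j) = idx (r, s) \<longleftrightarrow> (i, j) = (r, s)"
    using assms by (auto dest: inj_onD)
  then show ?thesis using False by (auto simp: gz_int_coord_def axis_def)
qed

lemma gz_rest_shift:
  assumes inj: "inj_on idx (gz_index n)" and rs: "(r, s) \<in> gz_index n"
  shows "gz_rest n lam idx r s (z - axis (idx (r, s)) 1) = gz_rest n lam idx r s z"
proof -
  let ?z = "z - axis (idx (r, s)) 1"
  have shift: "gz_int_coord n lam idx (z - axis (idx (r, s)) 1) i j = gz_int_coord n lam idx z i j"
    if "i = 0 \<or> (i, j) \<in> gz_index n" "(i, j) \<noteq> (r, s)" for i j
    using gz_int_coord_shift[OF inj rs that(1)] unfolding if_not_P[OF that(2)] by (simp only: diff_zero)
  have above: "i - 1 = 0 \<or> (i - 1, j) \<in> gz_index n" "i - 1 = 0 \<or> (i - 1, j + 1) \<in> gz_index n"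
    if "(i, j) \<in> gz_index n" for i j
    using that by (auto simp: gz_index_def)
  show ?thesis
    unfolding gz_rest_def
  proof (rule ball_cong[OF refl])
    fix p assume "p \<in> gz_index n"
    moreover obtain i j where p: "p = (i, j)" by (cases p)
    ultimately have ij: "(i, j) \<in> gz_index n" by simp
    note shifts = shift[OF disjI2[OF ij]] shift[OF above(1)[OF ij]] shift[OF above(2)[OF ij]]
    show "(case p of (i, j) \<Rightarrow> (i, j) \<noteq> (r, s) \<longrightarrow>
        ((i - 1, j) \<noteq> (r, s) \<longrightarrow> gz_int_coord n lam idx ?z (i - 1) j \<le> gz_int_coord n lam idx ?z i j) \<and>
        ((i - 1, j + 1) \<noteq> (r, s) \<longrightarrow>
           gz_int_coord n lam idx ?z i j \<le> gz_int_coord n lam idx ?z (i - 1) (j + 1))) =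
      (case p of (i, j) \<Rightarrow> (i, j) \<noteq> (r, s) \<longrightarrow>
        ((i - 1, j) \<noteq> (r, s) \<longrightarrow> gz_int_coord n lam idx z (i - 1) j \<le> gz_int_coord n lam idx z i j) \<and>
        ((i - 1, j + 1) \<noteq> (r, s) \<longrightarrow>
           gz_int_coord n lam idx z i j \<le> gz_int_coord n lam idx z (i - 1) (j + 1)))"
      unfolding p prod.case by (intro imp_cong conj_cong refl) (simp_all only: shifts not_False_eq_True)
  qed
qed

text \<open>
  The lattice points of the polytope at which \<open>x\<^sub>r\<^sub>s\<close> cannot be increased, respectively
  decreased: one of its upper, respectively lower, bounds is attained.
\<close>

definition gz_top ::
  "nat \<Rightarrow> (nat \<Rightarrow> int) \<Rightarrow> (nat \<times> nat \<Rightarrow> 'k) \<Rightarrow> nat \<Rightarrow> nat \<Rightarrow> int^'k \<Rightarrow> bool" where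
  "gz_top n lam idx r s z \<longleftrightarrow> of_int_vec z \<in> GZ n lam idx \<and>
     (gz_int_coord n lam idx z r s = gz_int_coord n lam idx z (r - 1) (s + 1) \<or>
      (r + 1, s) \<in> gz_index n \<and>
        gz_int_coord n lam idx z r s = gz_int_coord n lam idx z (r + 1) s)"

definition gz_bottom ::
  "nat \<Rightarrow> (nat \<Rightarrow> int) \<Rightarrow> (nat \<times> nat \<Rightarrow> 'k) \<Rightarrow> nat \<Rightarrow> nat \<Rightarrow> int^'k \<Rightarrow> bool" where
  "gz_bottom n lam idx r s z \<longleftrightarrow> of_int_vec z \<in> GZ n lam idx \<and>
     (gz_int_coord n lam idx z r s = gz_int_coord n lam idx z (r - 1) s \<or>
      (r + 1, s - 1) \<in> gz_index n \<and>
        gz_int_coord n lam idx z r s = gz_int_coord n lam idx z (r + 1) (s - 1))"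

text \<open>
  The interval of integers with lower bounds \<open>a\<close>, \<open>c\<close> and upper bounds \<open>b\<close>, \<open>d\<close>, where \<open>c\<close> and \<open>d\<close>
  are present only if \<open>C\<close>, respectively \<open>D\<close>, holds, compared with its shift by one.
\<close>

lemma interval_minus_shift:
  fixes x a b c d :: int
  shows "of_bool (R \<and> a \<le> x \<and> x \<le> b \<and> (D \<longrightarrow> x \<le> d) \<and> (C \<longrightarrow> c \<le> x))
      - of_bool (R \<and> a \<le> x - 1 \<and> x - 1 \<le> b \<and> (D \<longrightarrow> x - 1 \<le> d) \<and> (C \<longrightarrow> c \<le> x - 1))
    = (of_bool ((R \<and> a \<le> x \<and> x \<le> b \<and> (D \<longrightarrow> x \<le> d) \<and> (C \<longrightarrow> c \<le> x)) \<and>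
         (x = a \<or> C \<and> x = c))
      - of_bool ((R \<and> a \<le> x - 1 \<and> x - 1 \<le> b \<and> (D \<longrightarrow> x - 1 \<le> d) \<and> (C \<longrightarrow> c \<le> x - 1)) \<and>
         (x - 1 = b \<or> D \<and> x - 1 = d)) :: int)"
proof -
  have *: "of_bool P - of_bool Q = (of_bool (P \<and> S) - of_bool (Q \<and> T) :: int)"
    if "P \<Longrightarrow> \<not> S \<Longrightarrow> Q" "Q \<Longrightarrow> \<not> T \<Longrightarrow> P" "S \<Longrightarrow> \<not> Q" "T \<Longrightarrow> \<not> P" for P Q S T
    using that by (cases P; cases Q) auto
  show ?thesis by (rule *; auto)
qed

text \<open>
  Shifting the polytope by one step in the direction of \<open>x\<^sub>r\<^sub>s\<close> removes the bottom and adds the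
  shifted top: on every lattice line in that direction this is a statement about an interval of
  integers.
\<close>

lemma GZ_minus_shift:
  assumes inj: "inj_on idx (gz_index n)" and rs: "(r, s) \<in> gz_index n"
  shows "lattice_indicator (GZ n lam idx) z - lattice_indicator (GZ n lam idx) (z - axis (idx (r, s)) 1)
    = of_bool (gz_bottom n lam idx r s z)
      - of_bool (gz_top n lam idx r s (z - axis (idx (r, s)) 1))"
proof -
  let ?z = "z - axis (idx (r, s)) 1"
  let ?c = "gz_int_coord n lam idx"
  have r: "1 \<le> r" "1 \<le> s" "r + s \<le> n" using rs by (auto simp: gz_index_def)
  have above: "r - 1 = 0 \<or> (r - 1, s) \<in> gz_index n" "r - 1 = 0 \<or> (r - 1, s + 1) \<in> gz_index n"
    using r by (auto simp: gz_index_def)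
  have x: "?c ?z r s = ?c z r s - 1"
    using gz_int_coord_shift[OF inj rs disjI2[OF rs]] by simp
  have a: "?c ?z (r - 1) s = ?c z (r - 1) s"
    using gz_int_coord_shift[OF inj rs above(1)] r by simp
  have b: "?c ?z (r - 1) (s + 1) = ?c z (r - 1) (s + 1)"
    using gz_int_coord_shift[OF inj rs above(2)] by simp
  have d: "?c ?z (r + 1) s = ?c z (r + 1) s" if "(r + 1, s) \<in> gz_index n"
    using gz_int_coord_shift[OF inj rs disjI2[OF that]] by simp
  have c: "?c ?z (r + 1) (s - 1) = ?c z (r + 1) (s - 1)" if "(r + 1, s - 1) \<in> gz_index n"
    using gz_int_coord_shift[OF inj rs disjI2[OF that]] by simp
  have mem: "of_int_vec ?z \<in> GZ n lam idx \<longleftrightarrow> gz_rest n lam idx r s z \<and>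
      ?c z (r - 1) s \<le> ?c z r s - 1 \<and> ?c z r s - 1 \<le> ?c z (r - 1) (s + 1) \<and>
      ((r + 1, s) \<in> gz_index n \<longrightarrow> ?c z r s - 1 \<le> ?c z (r + 1) s) \<and>
      ((r + 1, s - 1) \<in> gz_index n \<longrightarrow> ?c z (r + 1) (s - 1) \<le> ?c z r s - 1)"
    unfolding of_int_vec_mem_GZ_split[OF rs] gz_rest_shift[OF inj rs] x a b
    by (simp only: c d cong: imp_cong)
  have top: "gz_top n lam idx r s ?z \<longleftrightarrow> of_int_vec ?z \<in> GZ n lam idx \<and>
      (?c z r s - 1 = ?c z (r - 1) (s + 1) \<or>
       (r + 1, s) \<in> gz_index n \<and> ?c z r s - 1 = ?c z (r + 1) s)"
    unfolding gz_top_def x b by (simp only: d cong: conj_cong)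
  show ?thesis
    unfolding lattice_indicator_eq_of_bool gz_bottom_def top mem of_int_vec_mem_GZ_split[OF rs, of z]
    by (rule interval_minus_shift)
qed

lemma top_chain:
  assumes rs: "(r, s) \<in> gz_index n"
  shows "(if (r, s) \<in> gz_index n then lattice_indicator (upper_facet n lam idx (r, s))
            else (\<lambda>z. 0)) z
       + (if (r + 1, s) \<in> gz_index n then lattice_indicator (lower_facet n lam idx (r + 1, s))
            else (\<lambda>z. 0)) z
       + - (if (r + 1, s) \<in> gz_index n \<and> (r, s) \<in> gz_index n
            then lattice_indicator (lower_facet n lam idx (r + 1, s) \<inter> upper_facet n lam idx (r, s))
            else (\<lambda>z. 0)) z
     = of_bool (gz_top n lam idx r s z)"
  using rs
  by (auto simp: lattice_indicator_def gz_top_def of_int_vec_mem_lower_facet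
      of_int_vec_mem_upper_facet)

lemma bottom_chain:
  assumes rs: "(r, s) \<in> gz_index n"
  shows "(if (r, s) \<in> gz_index n then lattice_indicator (lower_facet n lam idx (r, s))
            else (\<lambda>z. 0)) z
       + (if (r + 1, s - 1) \<in> gz_index n
            then lattice_indicator (upper_facet n lam idx (r + 1, s - 1)) else (\<lambda>z. 0)) z
       + - (if (r, s) \<in> gz_index n \<and> (r + 1, s - 1) \<in> gz_index n
            then lattice_indicator (lower_facet n lam idx (r, s) \<inter> upper_facet n lam idx (r + 1, s - 1))
            else (\<lambda>z. 0)) z
     = of_bool (gz_bottom n lam idx r s z)"
proof -
  have "s - 1 + 1 = s" using rs by (simp add: gz_index_def)
  then show ?thesis
    using rs
    by (auto simp: lattice_indicator_def gz_bottom_def of_int_vec_mem_lower_facet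
        of_int_vec_mem_upper_facet)
qed

lemma chain_class_add_diff:
  assumes "f \<in> carrier convex_chain_group" "g \<in> carrier convex_chain_group"
    "h \<in> carrier convex_chain_group"
  shows "chain_class f \<otimes>\<^bsub>polytope_group\<^esub> chain_class g
           \<otimes>\<^bsub>polytope_group\<^esub> inv\<^bsub>polytope_group\<^esub> chain_class h
         = chain_class (\<lambda>z. f z + g z + - h z)"
    and "(\<lambda>z. f z + g z + - h z) \<in> carrier convex_chain_group"
  using assms by (simp_all only: chain_class_add chain_class_uminus add_convex_chain
      uminus_convex_chain)

theorem theorem6p7:
  fixes n r s :: nat and lam :: "nat \<Rightarrow> int" and idx :: "nat \<times> nat \<Rightarrow> 'k::finite"
  assumes "n \<ge> 2"
    and "strict_antimono_on {1..n} lam"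
    and "bij_betw idx (gz_index n) (UNIV :: 'k set)"
    and "1 \<le> r" and "r \<le> n - 1" and "1 \<le> s" and "s \<le> n - r"
  shows
    "upper_class n lam idx (r, s)
       \<otimes>\<^bsub>polytope_group\<^esub> lower_class n lam idx (r + 1, s)
       \<otimes>\<^bsub>polytope_group\<^esub> inv\<^bsub>polytope_group\<^esub> lower_upper_class n lam idx (r + 1, s) (r, s)
     = lower_class n lam idx (r, s)
       \<otimes>\<^bsub>polytope_group\<^esub> upper_class n lam idx (r + 1, s - 1)
       \<otimes>\<^bsub>polytope_group\<^esub> inv\<^bsub>polytope_group\<^esub> lower_upper_class n lam idx (r, s) (r + 1, s - 1)"
proof -
  have rs: "(r, s) \<in> gz_index n" using assms by (auto simp: gz_index_def)
  have inj: "inj_on idx (gz_index n)" and surj: "idx ` gz_index n = UNIV"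
    using assms(3) by (auto simp: bij_betw_def)
  have chain: "(if c then lattice_indicator P else (\<lambda>z. 0)) \<in> carrier convex_chain_group"
    if "integral_polytope P" for c and P :: "(real^'k) set"
    using that by (simp add: lattice_indicator_convex_chain zero_convex_chain)
  note chains = chain[OF integral_polytope_lower_facet[OF surj]]
    chain[OF integral_polytope_upper_facet[OF surj]]
    chain[OF integral_polytope_lower_Int_upper_facet[OF surj]]
  note top = chain_class_add_diff[OF chains(2) chains(1) chains(3),
      of "(r, s) \<in> gz_index n" lam "(r, s)" "(r + 1, s) \<in> gz_index n" lam "(r + 1, s)"
      "(r + 1, s) \<in> gz_index n \<and> (r, s) \<in> gz_index n" lam "(r + 1, s)" "(r, s)",
      unfolded top_chain[OF rs]]
  note bottom = chain_class_add_diff[OF chains(1) chains(2) chains(3),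
      of "(r, s) \<in> gz_index n" lam "(r, s)" "(r + 1, s - 1) \<in> gz_index n" lam "(r + 1, s - 1)"
      "(r, s) \<in> gz_index n \<and> (r + 1, s - 1) \<in> gz_index n" lam "(r, s)" "(r + 1, s - 1)",
      unfolded bottom_chain[OF rs]]
  have "chain_class (\<lambda>z. of_bool (gz_bottom n lam idx r s z))
      = chain_class (\<lambda>z. of_bool (gz_top n lam idx r s z))"
    by (rule chain_class_eq_by_shift[OF bottom(2) top(2) integral_polytope_GZ[OF surj]
          GZ_minus_shift[OF inj rs]])
  then show ?thesis
    unfolding upper_class_def lower_class_def lower_upper_class_def polytope_class_if
      top(1) bottom(1) by (rule sym)
qed

end
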